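(* Let $n\ge2$, $N=\{1,\dots,n\}$, let $F_1,\dots,F_n$ be cumulative distribution functions of distributions on $[0,\infty)$, with $\overline F_i=1-F_i$. For each $i\in N$ let $G_i:[0,1]\to[0,1]$ be a non-decreasing, left-continuous function satisfying $G_i(u)=0$ for $u\in[0,a_i]$ and $G_i(u)=1$ for $u\in[b_i,1]$, where $0\le a_i<b_i\le\overline F_i(0)$, and let $$G_i^*=\inf_{\substack{0\le x<y\\ G_i(\overline F_i(x))>G_i(\overline F_i(y))}}\frac{\overline F_i(x)-\overline F_i(y)}{G_i(\overline F_i(x))-G_i(\overline F_i(y))}.$$ A G-JE random vector $X_N=(X_1,\dots,X_n)$ with marginals $F_1,\dots,F_n$ (with respect to the functions $G_1,\dots,G_n$) exists if and only if $$\sum_{i\in N}\overline F_i(0)-1\le\min\Bigl\{\frac{n-2}{n-1}\sum_{i\in N}G_i^*,\;\sum_{i\in N}G_i^*-\max_{i\in N}G_i^*\Bigr\}.$$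
   Context: Let $M=\{I\subset N: 2\le|I|\le n-1\}$ and $M_i=\{I\in M: i\in I\}$. With $F_i$, $G_i$, $G_i^*$ as in the claim, a non-negative random vector $X_N=(X_1,\dots,X_n)$ with marginal cumulative distribution functions $F_1,\dots,F_n$ is called G-JE (generalised jointly exclusive, with respect to $G_1,\dots,G_n$) if there are coefficients $p_I\ge0$ and copulas $C_I$ on $[0,1]^{|I|}$, $I\in M$, such that: (a) for each $I\in M$ and all $x_i\in[0,\infty)$, $i\in I$, $$\mathbb{P}(X_i>x_i,\ i\in I;\ X_j=0,\ j\in N\setminus I)=p_I\,C_I\bigl(G_i(\overline F_i(x_i)),\ i\in I\bigr);$$ (b) for each $i\in N$ and $x_i\in[0,\infty)$, $$\mathbb{P}(X_i>x_i;\ X_j=0,\ j\in N\setminus\{i\})=\overline F_i(x_i)-\Bigl(\sum_{I\in M_i}p_I\Bigr)G_i(\overline F_i(x_i));$$ (c) $\displaystyle \mathbb{P}(X_i=0,\ i\in N)=1-\sum_{i\in N}\overline F_i(0)+\sum_{I\in M}(|I|-1)p_I$; (d) the coefficients satisfy $\displaystyle\sum_{I\in M}(|I|-1)p_I\ge\sum_{i\in N}\overline F_i(0)-1$ and $\displaystyle\sum_{I\in M_i}p_I\le G_i^*$ for all $i\in N$.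
   Formalization: The infimum defining G_i^* also allows y=∞ (with F̄_i(∞)=0); with finite y only, the claim fails when F̄_i>0 everywhere and G_i(0+)>0 (e.g. n=3, F̄_i(x)=e^{-x}/2, G_i(u)=1/2+u on (0,1/2]); otherwise G_i^* is unchanged. *)

theory Defs
  imports "HOL-Probability.Probability"
begin

definition nonneg_cdf :: "(real \<Rightarrow> real) \<Rightarrow> bool" where
  "nonneg_cdf F \<longleftrightarrow> (\<exists>\<mu>. real_distribution \<mu> \<and> measure \<mu> {0..} = 1 \<and> F = cdf \<mu>)"

definition surv :: "(real \<Rightarrow> real) \<Rightarrow> real \<Rightarrow> real" where
  "surv F x = 1 - F x"

definition surv_ext :: "(real \<Rightarrow> real) \<Rightarrow> ereal \<Rightarrow> real" where
  "surv_ext F y = (if y = \<infinity> then 0 else surv F (real_of_ereal y))"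

text \<open>
  The infimum ranges over \<open>0 \<le> x < y\<close> with \<open>y = \<infinity>\<close> allowed. When \<open>G (surv F y)\<close> tends to \<open>0\<close>
  as \<open>y \<rightarrow> \<infinity>\<close> (that is, when \<open>1 - G (surv F y)\<close> is itself a distribution function) this is the
  infimum over real \<open>y\<close>; see \<open>G_star_real\<close> below. It differs only if \<open>F < 1\<close> everywhere
  and \<open>G\<close> jumps at \<open>0\<close>. There, real \<open>y\<close> alone can give a positive infimum, or the infimum of the
  empty set, although in \<open>GJE\<close> the formula for the probability that \<open>X i > x\<close> and all other
  components are \<open>0\<close> forces, for \<open>x \<rightarrow> \<infinity>\<close>, the coefficients \<open>p I\<close> with \<open>i \<in> I\<close> to vanish; this
  matches the value \<open>0\<close> obtained here.
\<close>

definition G_star :: "(real \<Rightarrow> real) \<Rightarrow> (real \<Rightarrow> real) \<Rightarrow> real" where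
  "G_star F G = Inf {(surv F x - surv_ext F y) / (G (surv F x) - G (surv_ext F y)) | x y.
     0 \<le> x \<and> ereal x < y \<and> G (surv F x) > G (surv_ext F y)}"

text \<open>
  A copula on \<open>[0,1]\<^sup>I\<close>: the restriction to \<open>[0,1]\<^sup>I\<close> of a joint distribution function with
  standard uniform margins. Its arguments are extensional functions on \<open>I\<close>; values of \<open>C\<close> elsewhere
  are irrelevant.
\<close>

definition copula :: "'i set \<Rightarrow> (('i \<Rightarrow> real) \<Rightarrow> real) \<Rightarrow> bool" where
  "copula I C \<longleftrightarrow> (\<exists>\<mu>. prob_space \<mu> \<and> sets \<mu> = sets (PiM I (\<lambda>_. borel)) \<and>
     (\<forall>i\<in>I. distr \<mu> borel (\<lambda>\<omega>. \<omega> i) = uniform_measure lborel {0..1}) \<and>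
     (\<forall>u \<in> I \<rightarrow>\<^sub>E {0..1}. C u = measure \<mu> {\<omega>\<in>space \<mu>. \<forall>i\<in>I. \<omega> i \<le> u i}))"

definition index_family :: "nat \<Rightarrow> nat set set" where
  "index_family n = {I. I \<subseteq> {1..n} \<and> 2 \<le> card I \<and> card I \<le> n - 1}"

definition index_family_at :: "nat \<Rightarrow> nat \<Rightarrow> nat set set" where
  "index_family_at n i = {I \<in> index_family n. i \<in> I}"

definition nonneg_random_vector ::
    "nat \<Rightarrow> 'w measure \<Rightarrow> (nat \<Rightarrow> 'w \<Rightarrow> real) \<Rightarrow> (nat \<Rightarrow> real \<Rightarrow> real) \<Rightarrow> bool" where
  "nonneg_random_vector n P X F \<longleftrightarrow> prob_space P \<and>
     (\<forall>i\<in>{1..n}. X i \<in> borel_measurable P \<and> (\<forall>\<omega>\<in>space P. 0 \<le> X i \<omega>) \<and>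
        cdf (distr P borel (X i)) = F i)"

definition GJE ::
    "nat \<Rightarrow> (nat \<Rightarrow> real \<Rightarrow> real) \<Rightarrow> (nat \<Rightarrow> real \<Rightarrow> real) \<Rightarrow> 'w measure \<Rightarrow> (nat \<Rightarrow> 'w \<Rightarrow> real) \<Rightarrow> bool"
  where
  "GJE n F G P X \<longleftrightarrow> nonneg_random_vector n P X F \<and>
     (\<exists>(p :: nat set \<Rightarrow> real) (C :: nat set \<Rightarrow> (nat \<Rightarrow> real) \<Rightarrow> real).
        (\<forall>I\<in>index_family n. 0 \<le> p I \<and> copula I (C I)) \<and>
        (\<forall>I\<in>index_family n. \<forall>x. (\<forall>i\<in>I. 0 \<le> x i) \<longrightarrow>
           measure P {\<omega>\<in>space P. (\<forall>i\<in>I. X i \<omega> > x i) \<and> (\<forall>j\<in>{1..n} - I. X j \<omega> = 0)}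
             = p I * C I (\<lambda>i\<in>I. G i (surv (F i) (x i)))) \<and>
        (\<forall>i\<in>{1..n}. \<forall>x\<ge>0.
           measure P {\<omega>\<in>space P. X i \<omega> > x \<and> (\<forall>j\<in>{1..n} - {i}. X j \<omega> = 0)}
             = surv (F i) x - (\<Sum>I\<in>index_family_at n i. p I) * G i (surv (F i) x)) \<and>
        measure P {\<omega>\<in>space P. \<forall>i\<in>{1..n}. X i \<omega> = 0}
          = 1 - (\<Sum>i\<in>{1..n}. surv (F i) 0) + (\<Sum>I\<in>index_family n. (real (card I) - 1) * p I) \<and>
        (\<Sum>I\<in>index_family n. (real (card I) - 1) * p I) \<ge> (\<Sum>i\<in>{1..n}. surv (F i) 0) - 1 \<and>
        (\<forall>i\<in>{1..n}. (\<Sum>I\<in>index_family_at n i. p I) \<le> G_star (F i) (G i)))"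

text \<open>
  Being G-JE is a property of the law of the vector, so sample space \<open>nat \<Rightarrow> real\<close> is general enough
  for existence statements.
\<close>

lemma GJE_transfer:
  fixes P :: "'w measure"
  assumes "GJE n F G P X"
  shows "\<exists>(Q :: (nat \<Rightarrow> real) measure) Y. GJE n F G Q Y"
proof -
  let ?N = "{1..n}"
  let ?S = "PiM ?N (\<lambda>_. borel :: real measure)"
  define T where "T = (\<lambda>\<omega>. \<lambda>i\<in>?N. X i \<omega>)"
  define Q where "Q = distr P ?S T"
  define Y where "Y = (\<lambda>i (\<omega> :: nat \<Rightarrow> real). max 0 (\<omega> i))"
  from assms have P: "prob_space P"
    and X: "\<And>i. i \<in> ?N \<Longrightarrow> X i \<in> borel_measurable P"
    and pos: "\<And>i \<omega>. i \<in> ?N \<Longrightarrow> \<omega> \<in> space P \<Longrightarrow> 0 \<le> X i \<omega>"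
    and m: "\<And>i. i \<in> ?N \<Longrightarrow> cdf (distr P borel (X i)) = F i"
    by (auto simp: GJE_def nonneg_random_vector_def)
  have T: "T \<in> measurable P ?S"
    unfolding T_def by (rule measurable_restrict) (use X in auto)
  have Y: "Y i \<in> borel_measurable ?S" if "i \<in> ?N" for i
    unfolding Y_def using that by measurable
  have sp: "space Q = space ?S" by (simp add: Q_def)
  have YT: "Y i (T \<omega>) = X i \<omega>" if "i \<in> ?N" "\<omega> \<in> space P" for i \<omega>
    using pos[OF that] that by (simp add: Y_def T_def)
  have Tin: "T \<omega> \<in> space ?S" if "\<omega> \<in> space P" for \<omega>
    using measurable_space[OF T that] .
  have ev: "measure Q {\<omega>\<in>space Q. R (\<lambda>i. Y i \<omega>)} = measure P {\<omega>\<in>space P. R (\<lambda>i. X i \<omega>)}"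
    if meas: "{\<omega>\<in>space ?S. R (\<lambda>i. Y i \<omega>)} \<in> sets ?S"
      and loc: "\<And>f g. (\<forall>i\<in>?N. f i = g i) \<Longrightarrow> R f = R g"
    for R :: "(nat \<Rightarrow> real) \<Rightarrow> bool"
  proof -
    have "T -` {\<omega>\<in>space ?S. R (\<lambda>i. Y i \<omega>)} \<inter> space P = {\<omega>\<in>space P. R (\<lambda>i. X i \<omega>)}"
    proof (intro set_eqI)
      fix \<omega>
      have "R (\<lambda>i. Y i (T \<omega>)) = R (\<lambda>i. X i \<omega>)" if "\<omega> \<in> space P"
        by (rule loc) (use YT that in auto)
      then show "\<omega> \<in> T -` {\<omega>\<in>space ?S. R (\<lambda>i. Y i \<omega>)} \<inter> space P \<longleftrightarrow>
          \<omega> \<in> {\<omega>\<in>space P. R (\<lambda>i. X i \<omega>)}"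
        using Tin by auto
    qed
    then show ?thesis
      unfolding sp unfolding Q_def by (subst measure_distr[OF T meas]) simp
  qed
  have vec: "nonneg_random_vector n Q Y F"
  proof -
    have "cdf (distr Q borel (Y i)) = F i" if i: "i \<in> ?N" for i
    proof -
      have "distr Q borel (Y i) = distr P borel (Y i \<circ> T)"
        unfolding Q_def by (rule distr_distr[OF Y[OF i] T])
      also have "\<dots> = distr P borel (X i)"
        by (rule distr_cong) (use YT i in auto)
      finally show ?thesis using m[OF i] by simp
    qed
    moreover have "prob_space Q" unfolding Q_def by (rule prob_space.prob_space_distr[OF P T])
    moreover have "Y i \<in> borel_measurable Q" if "i \<in> ?N" for i
      using Y[OF that] by (simp add: Q_def)
    ultimately show ?thesis by (auto simp: nonneg_random_vector_def Y_def)
  qed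
  have evA: "measure Q {\<omega>\<in>space Q. (\<forall>i\<in>I. Y i \<omega> > x i) \<and> (\<forall>j\<in>?N - J. Y j \<omega> = 0)} =
      measure P {\<omega>\<in>space P. (\<forall>i\<in>I. X i \<omega> > x i) \<and> (\<forall>j\<in>?N - J. X j \<omega> = 0)}"
    if "I \<subseteq> ?N" for I J and x :: "nat \<Rightarrow> real"
  proof (rule ev)
    have f: "finite I" using that finite_subset by blast
    show "{\<omega>\<in>space ?S. (\<forall>i\<in>I. Y i \<omega> > x i) \<and> (\<forall>j\<in>?N - J. Y j \<omega> = 0)} \<in> sets ?S"
    proof (intro sets.sets_Collect_conj sets.sets_Collect_finite_All f)
      show "{\<omega> \<in> space ?S. x i < Y i \<omega>} \<in> sets ?S" if "i \<in> I" for i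
        by (rule borel_measurable_less) (use Y that \<open>I \<subseteq> ?N\<close> in auto)
      show "{\<omega> \<in> space ?S. Y j \<omega> = 0} \<in> sets ?S" if "j \<in> ?N - J" for j
        by (rule borel_measurable_eq) (use Y that in auto)
    qed auto
  qed (use that in \<open>auto simp: subset_iff\<close>)
  have evB: "measure Q {\<omega>\<in>space Q. Y i \<omega> > t \<and> (\<forall>j\<in>?N - {i}. Y j \<omega> = 0)} =
      measure P {\<omega>\<in>space P. X i \<omega> > t \<and> (\<forall>j\<in>?N - {i}. X j \<omega> = 0)}"
    if "i \<in> ?N" for i t
    using evA[of "{i}" "\<lambda>_. t" "{i}"] that by simp
  have evC: "measure Q {\<omega>\<in>space Q. \<forall>i\<in>?N. Y i \<omega> = 0} =
      measure P {\<omega>\<in>space P. \<forall>i\<in>?N. X i \<omega> = 0}"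
    using evA[of "{}" "\<lambda>_. 0" "{}"] by simp
  have sub: "I \<subseteq> ?N" if "I \<in> index_family n" for I
    using that by (simp add: index_family_def)
  have "GJE n F G Q Y"
  proof -
    from assms[unfolded GJE_def, THEN conjunct2] obtain p C where pC:
      "\<forall>I\<in>index_family n. 0 \<le> p I \<and> copula I (C I)"
      "\<forall>I\<in>index_family n. \<forall>x. (\<forall>i\<in>I. 0 \<le> x i) \<longrightarrow>
         measure P {\<omega>\<in>space P. (\<forall>i\<in>I. X i \<omega> > x i) \<and> (\<forall>j\<in>?N - I. X j \<omega> = 0)}
           = p I * C I (\<lambda>i\<in>I. G i (surv (F i) (x i)))"
      "\<forall>i\<in>?N. \<forall>x\<ge>0. measure P {\<omega>\<in>space P. X i \<omega> > x \<and> (\<forall>j\<in>?N - {i}. X j \<omega> = 0)}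
         = surv (F i) x - (\<Sum>I\<in>index_family_at n i. p I) * G i (surv (F i) x)"
      "measure P {\<omega>\<in>space P. \<forall>i\<in>?N. X i \<omega> = 0}
         = 1 - (\<Sum>i\<in>?N. surv (F i) 0) + (\<Sum>I\<in>index_family n. (real (card I) - 1) * p I)"
      "(\<Sum>I\<in>index_family n. (real (card I) - 1) * p I) \<ge> (\<Sum>i\<in>?N. surv (F i) 0) - 1"
      "\<forall>i\<in>?N. (\<Sum>I\<in>index_family_at n i. p I) \<le> G_star (F i) (G i)"
      by blast
    show ?thesis
      unfolding GJE_def
    proof (intro conjI exI[of _ p] exI[of _ C] ballI allI impI vec)
      fix I and x :: "nat \<Rightarrow> real" assume "I \<in> index_family n" "\<forall>i\<in>I. 0 \<le> x i"
      then show "measure Q {\<omega>\<in>space Q. (\<forall>i\<in>I. Y i \<omega> > x i) \<and> (\<forall>j\<in>?N - I. Y j \<omega> = 0)}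
          = p I * C I (\<lambda>i\<in>I. G i (surv (F i) (x i)))"
        using pC(2)[rule_format, of I x] evA[OF sub, of I x I] by simp
    next
      fix i and x :: real assume "i \<in> ?N" "0 \<le> x"
      then show "measure Q {\<omega>\<in>space Q. Y i \<omega> > x \<and> (\<forall>j\<in>?N - {i}. Y j \<omega> = 0)}
          = surv (F i) x - (\<Sum>I\<in>index_family_at n i. p I) * G i (surv (F i) x)"
        using pC(3)[rule_format, of i x] evB[of i x] by simp
    qed (use pC evC in auto)
  qed
  then show ?thesis by blast
qed

lemma G_star_real:
  assumes F: "nonneg_cdf F" and G: "mono_on {0..1} G" "G 0 = 0" "G (surv F 0) > 0"
    and lim: "((\<lambda>y. G (surv F y)) \<longlongrightarrow> 0) at_top"
  shows "G_star F G = Inf {(surv F x - surv F y) / (G (surv F x) - G (surv F y)) | x y.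
     0 \<le> x \<and> x < y \<and> G (surv F x) > G (surv F y)}" (is "_ = Inf ?B")
proof -
  let ?A = "{(surv F x - surv_ext F y) / (G (surv F x) - G (surv_ext F y)) | x y.
     0 \<le> x \<and> ereal x < y \<and> G (surv F x) > G (surv_ext F y)}"
  obtain \<mu> where \<mu>: "real_distribution \<mu>" "F = cdf \<mu>" using F by (auto simp: nonneg_cdf_def)
  interpret real_distribution \<mu> by fact
  have Flim: "(surv F \<longlongrightarrow> 0) at_top"
    using tendsto_diff[OF tendsto_const[of 1] cdf_lim_at_top_prob] \<mu>(2) by (simp add: surv_def[abs_def])
  have anti: "surv F y \<le> surv F x" if "x \<le> y" for x y
    using that cdf_nondecreasing \<mu>(2) by (simp add: surv_def)
  have rng: "0 \<le> surv F x \<and> surv F x \<le> 1" for x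
    using cdf_bounded_prob cdf_nonneg \<mu>(2) by (simp add: surv_def)
  have BA: "?B \<subseteq> ?A"
  proof
    fix r assume "r \<in> ?B"
    then obtain x y where "r = (surv F x - surv F y) / (G (surv F x) - G (surv F y))"
      "0 \<le> x" "x < y" "G (surv F x) > G (surv F y)" by blast
    then show "r \<in> ?A" by (auto simp: surv_ext_def intro!: exI[of _ x] exI[of _ "ereal y"])
  qed
  have lb: "0 \<le> r" if "r \<in> ?A" for r
  proof -
    from that obtain x y where r: "r = (surv F x - surv_ext F y) / (G (surv F x) - G (surv_ext F y))"
      "ereal x < y" "G (surv F x) > G (surv_ext F y)" by blast
    have "surv_ext F y \<le> surv F x"
      using r(2) rng[of x] anti[of x "real_of_ereal y"] by (cases y) (auto simp: surv_ext_def)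
    then show ?thesis using r by simp
  qed
  have bdA: "bdd_below ?A" by (rule bdd_belowI[of _ 0]) (rule lb)
  have bdB: "bdd_below ?B" by (rule bdd_below_mono[OF bdA BA])
  have ev: "eventually (\<lambda>y. (surv F x - surv F y) / (G (surv F x) - G (surv F y)) \<in> ?B) at_top"
    if "0 \<le> x" "G (surv F x) > 0" for x
  proof -
    have "eventually (\<lambda>y. G (surv F y) < G (surv F x)) at_top"
      using order_tendstoD(2)[OF lim that(2)] .
    moreover have "eventually (\<lambda>y. x < y) at_top" by (rule eventually_gt_at_top)
    ultimately show ?thesis by eventually_elim (use that in blast)
  qed
  have neB: "?B \<noteq> {}"
  proof
    assume B: "?B = {}"
    show False using ev[OF order_refl G(3), unfolded B] by simp
  qed
  have neA: "?A \<noteq> {}" using neB BA by blast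
  have "Inf ?B \<le> r" if "r \<in> ?A" for r
  proof -
    from that obtain x y where r: "r = (surv F x - surv_ext F y) / (G (surv F x) - G (surv_ext F y))"
      "0 \<le> x" "ereal x < y" "G (surv F x) > G (surv_ext F y)" by blast
    show ?thesis
    proof (cases "y = \<infinity>")
      case False
      then obtain z where z: "y = ereal z" using r(3) by (cases y) auto
      then have "r \<in> ?B" using r by (auto simp: surv_ext_def)
      then show ?thesis by (rule cInf_lower[OF _ bdB])
    next
      case True
      then have pos: "G (surv F x) > 0" using r(4) G(2) by (simp add: surv_ext_def)
      have "((\<lambda>y. (surv F x - surv F y) / (G (surv F x) - G (surv F y))) \<longlongrightarrow>
          (surv F x - 0) / (G (surv F x) - 0)) at_top"
        by (intro tendsto_intros Flim lim) (use pos in simp)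
      moreover have "eventually (\<lambda>y. Inf ?B \<le> (surv F x - surv F y) / (G (surv F x) - G (surv F y))) at_top"
        using ev[OF r(2) pos] by eventually_elim (rule cInf_lower[OF _ bdB])
      ultimately have "Inf ?B \<le> (surv F x - 0) / (G (surv F x) - 0)"
        by (rule tendsto_lowerbound) simp
      then show ?thesis using r(1) True G(2) by (simp add: surv_ext_def)
    qed
  qed
  then have "Inf ?B \<le> Inf ?A" by (intro cInf_greatest[OF neA])
  moreover have "Inf ?A \<le> Inf ?B" by (rule cInf_superset_mono[OF neB bdA BA])
  ultimately show ?thesis unfolding G_star_def by simp
qed

end

theory Submission
  imports Defs
begin

text \<open>
  The claim splits into a linear program for the coefficients and a construction of the vector.

  Write \<open>q i\<close> for the value of \<open>G_star\<close> at \<open>i\<close>, \<open>Q\<close> for the sum of the \<open>q i\<close> and \<open>T\<close> for the larger of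
  \<open>Q / (n - 1)\<close> and \<open>max q\<close>, so that the bound in the theorem is \<open>Q - T\<close>. Subject to the marginal
  constraints, the sum of \<open>(card I - 1) * p I\<close> is at most \<open>Q - T\<close> by double counting. The value is
  attained by choosing \<open>t\<close> in \<open>[0, T)\<close>, covering \<open>[0, T)\<close> by intervals \<open>D i\<close> of length \<open>T - q i\<close> and
  letting \<open>p I\<close> be the length of the set of those \<open>t\<close> for which \<open>I\<close> consists of the \<open>i\<close> with
  \<open>t \<notin> D i\<close>; the covering excludes the full set.

  Given coefficients with marginal sums \<open>R i \<le> q i\<close>, a random set of positive components is drawn,
  and these components are then drawn independently, which gives product copulas. The
  definition of \<open>G_star\<close> is exactly what makes \<open>surv F x - R i * G (surv F x)\<close> non-increasing and
  forces \<open>R i * G (surv F x)\<close> to vanish at infinity, so both are multiples of survival functions.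
\<close>

section \<open>Independence copula and laws with a given survival function\<close>

text \<open>Take independent uniform coordinates: the box of points below \<open>u\<close> has the
  product of the lengths \<open>u i\<close> as its measure.\<close>

lemma copula_prod:
  assumes "finite I"
  shows "copula I (\<lambda>u. \<Prod>i\<in>I. u i)"
proof -
  let ?U = "uniform_measure lborel {0..1::real}"
  have U: "prob_space ?U" by (rule prob_space_uniform_measure) auto
  interpret U: finite_product_prob_space "\<lambda>_. ?U" I
    using U assms by (simp add: finite_product_prob_space_def finite_product_sigma_finite_def
        product_sigma_finite_def product_prob_space_def product_prob_space_axioms_def
        finite_product_sigma_finite_axioms_def prob_space_imp_sigma_finite)
  have "prob_space (PiM I (\<lambda>_. ?U))" by (rule prob_space_PiM) (rule U)
  moreover have "sets (PiM I (\<lambda>_. ?U)) = sets (PiM I (\<lambda>_. borel))"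
    by (rule sets_PiM_cong) auto
  moreover have "distr (PiM I (\<lambda>_. ?U)) borel (\<lambda>\<omega>. \<omega> i) = ?U" if "i \<in> I" for i
  proof -
    have "distr (PiM I (\<lambda>_. ?U)) borel (\<lambda>\<omega>. \<omega> i) = distr (PiM I (\<lambda>_. ?U)) ?U (\<lambda>\<omega>. \<omega> i)"
      by (rule distr_cong) auto
    then show ?thesis using distr_PiM_component[of I "\<lambda>_. ?U" i] U that by simp
  qed
  moreover have "(\<Prod>i\<in>I. u i) =
      measure (PiM I (\<lambda>_. ?U)) {\<omega>\<in>space (PiM I (\<lambda>_. ?U)). \<forall>i\<in>I. \<omega> i \<le> u i}"
    if u: "u \<in> I \<rightarrow>\<^sub>E {0..1}" for u
  proof -
    have "{\<omega>\<in>space (PiM I (\<lambda>_. ?U)). \<forall>i\<in>I. \<omega> i \<le> u i} = (\<Pi>\<^sub>E i\<in>I. {..u i})"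
      by (auto simp: space_PiM PiE_def Pi_def)
    moreover have "measure (PiM I (\<lambda>_. ?U)) (\<Pi>\<^sub>E i\<in>I. {..u i}) = (\<Prod>i\<in>I. measure ?U {..u i})"
      by (rule U.prob_times) auto
    moreover have "measure ?U {..u i} = u i" if "i \<in> I" for i
    proof -
      have "0 \<le> u i" "u i \<le> 1" using u that by (auto simp: PiE_iff)
      moreover have "{0..1} \<inter> {..u i} = {0..u i}" using \<open>u i \<le> 1\<close> by auto
      ultimately show ?thesis by (simp add: measure_uniform_measure)
    qed
    ultimately show ?thesis by simp
  qed
  ultimately show ?thesis unfolding copula_def by blast
qed

text \<open>
  The measure is the law of the logarithm, so that the variable with survival function \<open>s / s 0\<close> is
  strictly positive everywhere, not just almost surely. If \<open>s 0 = 0\<close>, any measure will do.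
\<close>

lemma survival_law:
  fixes s :: "real \<Rightarrow> real"
  assumes anti: "\<And>x y. 0 \<le> x \<Longrightarrow> x \<le> y \<Longrightarrow> s y \<le> s x"
    and cont: "\<And>x. 0 \<le> x \<Longrightarrow> continuous (at_right x) s"
    and lim: "(s \<longlongrightarrow> 0) at_top"
  shows "\<exists>\<mu>. real_distribution \<mu> \<and> (\<forall>x\<ge>0. s x = s 0 * measure \<mu> {w. x < exp w})"
proof (cases "s 0 = 0")
  case True
  have "s x = 0" if "0 \<le> x" for x
  proof -
    have "0 \<le> s x"
      by (rule tendsto_upperbound[OF lim eventually_at_top_linorderI[of x]]) (use anti that in auto)
    then show ?thesis using anti[of 0 x] that True by simp
  qed
  moreover have "real_distribution (return borel (0::real))"
    by (simp add: real_distribution_def real_distribution_axioms_def prob_space_return)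
  ultimately show ?thesis using True by auto
next
  case False
  have s0: "0 < s 0"
  proof -
    have "0 \<le> s 0"
      by (rule tendsto_upperbound[OF lim eventually_at_top_linorderI[of 0]]) (use anti in auto)
    then show ?thesis using False by simp
  qed
  define F where "F t = 1 - s (exp t) / s 0" for t
  have mono: "F x \<le> F y" if "x \<le> y" for x y
    using anti[of "exp x" "exp y"] that s0 by (simp add: F_def divide_right_mono)
  have exp_right: "filterlim exp (at_right (exp t)) (at_right t)" for t :: real
  proof (rule tendsto_imp_filterlim_at_right)
    show "(exp \<longlongrightarrow> exp t) (at_right t)" by (intro tendsto_intros)
    show "eventually (\<lambda>x. exp t < exp x) (at_right t)"
      by (auto simp: eventually_at_right_field intro: exI[of _ "t + 1"])
  qed
  have exp_bot: "filterlim exp (at_right (0::real)) at_bot"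
    by (rule exp_at_bot[THEN tendsto_imp_filterlim_at_right]) simp
  have Fcont: "continuous (at_right t) F" for t
    unfolding F_def continuous_within
    by (intro tendsto_intros filterlim_compose[OF _ exp_right])
       (use cont[of "exp t"] s0 in \<open>auto simp: continuous_within\<close>)
  \<comment> \<open>As \<open>t\<close> tends to minus infinity, \<open>exp t\<close> approaches
    \<open>0\<close> from the right, so right continuity of \<open>s\<close> at \<open>0\<close>
    keeps mass from escaping to minus infinity.\<close>
  have "(F \<longlongrightarrow> 1 - s 0 / s 0) at_bot"
    unfolding F_def
    by (intro tendsto_intros filterlim_compose[OF _ exp_bot])
       (use cont[of 0] s0 in \<open>auto simp: continuous_within\<close>)
  then have bot: "(F \<longlongrightarrow> 0) at_bot" using s0 by simp
  have "(F \<longlongrightarrow> 1 - 0 / s 0) at_top"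
    unfolding F_def
    by (intro tendsto_intros filterlim_compose[OF lim exp_at_top]) (use s0 in auto)
  then have top: "(F \<longlongrightarrow> 1) at_top" by simp
  define \<mu> where "\<mu> = interval_measure F"
  have rd: "real_distribution \<mu>"
    unfolding \<mu>_def by (rule real_distribution_interval_measure[OF mono Fcont bot top])
  then interpret real_distribution \<mu> .
  have cdf: "cdf \<mu> = F" unfolding \<mu>_def by (rule cdf_interval_measure[OF mono Fcont bot])
  have "s x = s 0 * measure \<mu> {w. x < exp w}" if x: "0 \<le> x" for x
  \<comment> \<open>Rewriting the event through \<open>ln x\<close> requires \<open>x > 0\<close>;
    for \<open>x = 0\<close> the event is the whole space.\<close>
  proof (cases "x = 0")
    case True
    then show ?thesis using prob_space by simp
  next
    case False
    then have "0 < x" using x by simp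
    then have "{w. x < exp w} = space \<mu> - {..ln x}"
      by (auto simp: ln_ge_iff not_le)
    then have "measure \<mu> {w. x < exp w} = 1 - measure \<mu> {..ln x}"
      using prob_compl[of "{..ln x}"] by simp
    moreover have "measure \<mu> {..ln x} = F (ln x)"
      unfolding cdf[symmetric] cdf_def ..
    moreover have "F (ln x) = 1 - s x / s 0" using \<open>0 < x\<close> by (simp add: F_def)
    ultimately have m: "measure \<mu> {w. x < exp w} = s x / s 0" by linarith
    show ?thesis unfolding m using s0 by simp
  qed
  then show ?thesis using rd by blast
qed

section \<open>Linear program: double counting and attainment of the optimum\<close>

text \<open>Double counting of the pairs \<open>(i, I)\<close> with \<open>i \<in> I\<close>,
  grouped by \<open>I\<close> on the left and by \<open>i\<close> on the right.\<close>

lemma sum_card_mult: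
  fixes p :: "'a set \<Rightarrow> real"
  assumes "finite A" "\<F> \<subseteq> Pow A"
  shows "(\<Sum>I\<in>\<F>. real (card I) * p I) = (\<Sum>i\<in>A. \<Sum>I\<in>{I\<in>\<F>. i \<in> I}. p I)"
proof -
  have fin: "finite \<F>" using assms by (meson finite_Pow_iff finite_subset)
  have "real (card I) * p I = (\<Sum>i\<in>A. if i \<in> I then p I else 0)" if "I \<in> \<F>" for I
  proof -
    have "A \<inter> I = I" using that assms(2) by auto
    then show ?thesis using assms(1) by (simp add: sum.If_cases)
  qed
  then have "(\<Sum>I\<in>\<F>. real (card I) * p I) = (\<Sum>I\<in>\<F>. \<Sum>i\<in>A. if i \<in> I then p I else 0)"
    by simp
  also have "\<dots> = (\<Sum>i\<in>A. \<Sum>I\<in>\<F>. if i \<in> I then p I else 0)" by (rule sum.swap)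
  also have "\<dots> = (\<Sum>i\<in>A. \<Sum>I\<in>{I\<in>\<F>. i \<in> I}. p I)"
    using fin by (simp add: sum.inter_filter)
  finally show ?thesis .
qed

lemma index_family_subset: "index_family n \<subseteq> Pow {1..n}"
  by (auto simp: index_family_def)

lemma finite_index_family [simp]: "finite (index_family n)"
  by (rule finite_subset[OF index_family_subset]) simp

text \<open>Each \<open>i\<close> is missing from \<open>K t\<close> exactly on \<open>D i\<close>,
  so its marginal sum over all subsets is \<open>T - (T - q i) = q i\<close>, while all weights
  together sum to \<open>T\<close>. Double counting then gives the objective the value
  \<open>Q - T\<close> over all subsets, and dropping those outside \<open>index_family n\<close>
  does not lower it.\<close>

lemma weights_exist:
  fixes q :: "nat \<Rightarrow> real" and n :: nat
  assumes n: "n \<ge> 2" and q0: "\<And>i. i \<in> {1..n} \<Longrightarrow> 0 \<le> q i"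
  defines "Q \<equiv> \<Sum>i\<in>{1..n}. q i"
  obtains p :: "nat set \<Rightarrow> real" where "\<And>I. 0 \<le> p I"
    and "\<And>i. i \<in> {1..n} \<Longrightarrow> (\<Sum>I\<in>index_family_at n i. p I) \<le> q i"
    and "min ((real n - 2) / (real n - 1) * Q) (Q - Max (q ` {1..n}))
      \<le> (\<Sum>I\<in>index_family n. (real (card I) - 1) * p I)"
proof -
  let ?N = "{1..n}"
  define T where "T = max (Q / (real n - 1)) (Max (q ` ?N))"
  have qT: "q i \<le> T" if "i \<in> ?N" for i
    using that by (auto simp: T_def intro!: max.coboundedI2 Max_ge)
  have T0: "0 \<le> T" using q0[of 1] qT[of 1] n by auto
  \<comment> \<open>Laid end to end from \<open>0\<close> and pushed back below \<open>T\<close>, the intervals \<open>D i\<close> cover \<open>[0, T)\<close>: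
    their total length \<open>n T - Q\<close> is at least \<open>T\<close>.\<close>
  define c where "c i = (\<Sum>j\<in>{1..i}. T - q j)" for i
  define e where "e i = min T (c i)" for i
  define D where "D i = {e i - (T - q i)..<e i}" for i
  have c_Suc: "c i = c (i - 1) + (T - q i)" if "i \<in> ?N" for i
    using that by (cases i) (auto simp: c_def)
  have c0: "0 \<le> c i" if "i \<le> n" for i
    unfolding c_def by (rule sum_nonneg) (use qT that in auto)
  have c_total: "T \<le> c n"
  proof -
    have "Q / (real n - 1) \<le> T" by (simp add: T_def)
    then have "Q \<le> T * (real n - 1)" using n by (simp add: pos_divide_le_eq)
    then show ?thesis by (simp add: c_def sum_subtractf Q_def algebra_simps)
  qed
  \<comment> \<open>Both entries of the minimum are at least \<open>T - q i\<close>, the second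
    because \<open>c (i - 1)\<close> is non-negative. Hence \<open>D i\<close> keeps its full length
    and lies in \<open>[0, T)\<close>.\<close>
  have e_bounds: "T - q i \<le> e i" "e i \<le> T" if "i \<in> ?N" for i
  proof -
    have "i - 1 \<le> n" using that by auto
    from c0[OF this] c_Suc[OF that] q0[OF that] show "T - q i \<le> e i" "e i \<le> T"
      by (auto simp: e_def)
  qed
  have cover: "\<exists>i\<in>?N. t \<in> D i" if t: "t \<in> {0..<T}" for t
  proof -
    \<comment> \<open>This is the first interval whose right end before truncation exceeds
      \<open>t\<close>; its left end is then at most \<open>t\<close>. Truncation never raises the
      left end, and it leaves the right end above \<open>t\<close> because
      \<open>t < T\<close>.\<close>
    define i where "i = (LEAST i. t < c i)"
    have "t < c n" using t c_total by auto
    then have "t < c i" "i \<le> n" unfolding i_def by (rule LeastI, rule Least_le)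
    have "c 0 = 0" by (simp add: c_def)
    then have "i \<noteq> 0" using \<open>t < c i\<close> t by (intro notI) auto
    then have i: "i \<in> ?N" using \<open>i \<le> n\<close> by simp
    have "\<not> t < c (i - 1)" using \<open>i \<noteq> 0\<close> unfolding i_def by (intro not_less_Least) simp
    then have "t \<in> D i" using \<open>t < c i\<close> t c_Suc[OF i] by (auto simp: D_def e_def)
    then show ?thesis using i by blast
  qed
  define K where "K t = {i\<in>?N. t \<notin> D i}" for t
  define E where "E J = {t\<in>{0..<T}. K t = J}" for J
  define p where "p J = measure lborel (E J)" for J
  have E_sets: "E J \<in> sets lborel" for J
  proof (cases "J \<subseteq> ?N")
    case True
    then have "E J = {t\<in>space lborel. t \<in> {0..<T} \<and> (\<forall>i\<in>?N. (t \<notin> D i) = (i \<in> J))}"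
      by (auto simp: E_def K_def)
    also have "\<dots> \<in> sets lborel" unfolding D_def by measurable
    finally show ?thesis .
  next
    case False
    then have "E J = {}" by (auto simp: E_def K_def)
    then show ?thesis by simp
  qed
  have E_fin: "emeasure lborel (E J) \<noteq> \<infinity>" for J
  proof -
    have "emeasure lborel (E J) \<le> emeasure lborel {0..<T}"
      by (rule emeasure_mono) (auto simp: E_def)
    then show ?thesis using T0 by (auto simp: top_unique)
  qed
  have sum_p: "(\<Sum>J\<in>\<J>. p J) = measure lborel {t\<in>{0..<T}. K t \<in> \<J>}" if "\<J> \<subseteq> Pow ?N" for \<J>
  proof -
    have fin: "finite \<J>" using that by (meson finite_Pow_iff finite_atLeastAtMost finite_subset)
    have "{t\<in>{0..<T}. K t \<in> \<J>} = (\<Union>J\<in>\<J>. E J)" by (auto simp: E_def)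
    moreover have "measure lborel (\<Union>J\<in>\<J>. E J) = (\<Sum>J\<in>\<J>. measure lborel (E J))"
      by (rule measure_finite_Union[OF fin])
         (use E_sets E_fin in \<open>auto simp: disjoint_family_on_def E_def\<close>)
    ultimately show ?thesis by (simp add: p_def)
  qed
  have marg: "(\<Sum>J\<in>{J\<in>Pow ?N. i \<in> J}. p J) = q i" if i: "i \<in> ?N" for i
  proof -
    have "(\<Sum>J\<in>{J\<in>Pow ?N. i \<in> J}. p J) = measure lborel ({0..<T} - D i)"
      by (subst sum_p) (use i in \<open>auto simp: K_def intro!: arg_cong[where f = "measure lborel"]\<close>)
    also have "\<dots> = measure lborel {0..<T} - measure lborel (D i)"
      by (rule measure_Diff) (use T0 e_bounds[OF i] in \<open>auto simp: D_def\<close>)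
    also have "\<dots> = q i" using T0 qT[OF i] by (simp add: D_def)
    finally show ?thesis .
  qed
  have "{t\<in>{0..<T}. K t \<in> Pow ?N} = {0..<T}" by (auto simp: K_def)
  then have total: "(\<Sum>J\<in>Pow ?N. p J) = T" using T0 by (simp add: sum_p)
  have "(\<Sum>J\<in>Pow ?N. real (card J) * p J) = Q"
    unfolding sum_card_mult[OF finite_atLeastAtMost subset_refl] Q_def
    by (rule sum.cong[OF refl marg])
  then have "Q - T = (\<Sum>J\<in>Pow ?N. (real (card J) - 1) * p J)"
    using total by (simp add: left_diff_distrib sum_subtractf del: One_nat_def)
  \<comment> \<open>The discarded sets contribute at most \<open>0\<close>: the full set has weight \<open>0\<close> by the covering.\<close>
  also have "\<dots> \<le> (\<Sum>J\<in>index_family n. (real (card J) - 1) * p J)"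
  proof -
    have "(real (card J) - 1) * p J \<le> 0" if J: "J \<in> Pow ?N - index_family n" for J
    proof (cases "J = ?N")
      case True
      then have "E J = {}" using cover by (auto simp: E_def K_def)
      then show ?thesis by (simp add: p_def)
    next
      case False
      then have "card J < n" using J psubset_card_mono[of ?N J] by auto
      then have "card J < 2" using J by (auto simp: index_family_def)
      then show ?thesis by (intro mult_nonpos_nonneg) (auto simp: p_def)
    qed
    then show ?thesis
      using sum.subset_diff[OF index_family_subset[of n], of "\<lambda>J. (real (card J) - 1) * p J"]
        sum_nonpos[of "Pow ?N - index_family n" "\<lambda>J. (real (card J) - 1) * p J"]
      by simp
  qed
  finally have "Q - T \<le> (\<Sum>J\<in>index_family n. (real (card J) - 1) * p J)" .
  moreover have "min ((real n - 2) / (real n - 1) * Q) (Q - Max (q ` ?N)) = Q - T"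
  proof -
    have "(real n - 2) / (real n - 1) * Q = Q - Q / (real n - 1)"
      using n by (simp add: field_simps)
    then show ?thesis by (simp add: T_def min_def max_def)
  qed
  moreover have "(\<Sum>I\<in>index_family_at n i. p I) \<le> q i" if "i \<in> ?N" for i
  proof -
    have "(\<Sum>I\<in>index_family_at n i. p I) \<le> (\<Sum>J\<in>{J\<in>Pow ?N. i \<in> J}. p J)"
      by (rule sum_mono2) (auto simp: index_family_at_def index_family_def p_def)
    then show ?thesis using marg[OF that] by simp
  qed
  ultimately show thesis using that[of p] by (simp add: p_def del: One_nat_def)
qed

section \<open>Mixture of independent components over a random label\<close>

text \<open>
  The label \<open>J\<close>, drawn with probability \<open>w J\<close>, is the set of positive components. Component \<open>i\<close> has
  one law, at index \<open>(i, True)\<close>, for when it is the only positive one, and another for when it is not.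
\<close>

lemma labelled_vector:
  fixes N :: "'i set" and w :: "'i set \<Rightarrow> real" and \<mu> :: "'i \<times> bool \<Rightarrow> real measure"
  assumes N: "finite N" and w0: "\<And>J. 0 \<le> w J" and w_out: "\<And>J. J \<notin> Pow N \<Longrightarrow> w J = 0"
    and w1: "(\<Sum>J\<in>Pow N. w J) = 1" and \<mu>: "\<And>k. real_distribution (\<mu> k)"
  obtains P :: "('i set \<times> ('i \<times> bool \<Rightarrow> real)) measure" and X
  where "prob_space P" and "\<And>i. X i \<in> borel_measurable P" and "\<And>i \<omega>. 0 \<le> X i \<omega>"
    and "\<And>I x. I \<subseteq> N \<Longrightarrow> \<forall>i\<in>I. 0 \<le> x i \<Longrightarrow>
      measure P {\<omega>\<in>space P. (\<forall>i\<in>I. x i < X i \<omega>) \<and> (\<forall>j\<in>N - I. X j \<omega> = 0)} =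
        w I * (\<Prod>i\<in>I. measure (\<mu> (i, I = {i})) {t. x i < exp t})"
    and "\<And>i x. 0 \<le> x \<Longrightarrow> measure P {\<omega>\<in>space P. x < X i \<omega>} =
        (\<Sum>J\<in>{J\<in>Pow N. i \<in> J}. w J * measure (\<mu> (i, J = {i})) {t. x < exp t})"
proof -
  define r where "r = embed_pmf w"
  have "(\<integral>\<^sup>+J. ennreal (w J) \<partial>count_space UNIV) = (\<Sum>J\<in>Pow N. ennreal (w J))"
    by (rule nn_integral_count_space'[where A = "Pow N"]) (use N w_out in auto)
  also have "\<dots> = ennreal (\<Sum>J\<in>Pow N. w J)" by (rule sum_ennreal) (rule w0)
  finally have pmf_r: "pmf r J = w J" for J
    unfolding r_def by (intro pmf_embed_pmf) (use w0 w1 in auto)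
  have set_r: "J \<in> Pow N" if "J \<in> set_pmf r" for J
    using that w_out by (auto simp: set_pmf_iff pmf_r)
  have prob: "prob_space (\<mu> k)" for k
    using \<mu>[of k] by (simp add: real_distribution_def)
  have sets_\<mu> [measurable_cong]: "sets (\<mu> k) = sets borel" for k
    using real_distribution.events_eq_borel[OF \<mu>[of k]] .
  interpret product_prob_space \<mu> UNIV
    using prob by (simp add: product_prob_space_def product_sigma_finite_def
        product_prob_space_axioms_def prob_space_imp_sigma_finite)
  define Q where "Q = PiM UNIV \<mu>"
  have "prob_space Q" unfolding Q_def by (rule prob_space_PiM) (rule prob)
  then interpret Q: prob_space Q .
  have comp [measurable]: "(\<lambda>\<omega>. \<omega> k) \<in> borel_measurable Q" for k
    unfolding Q_def by measurable
  have cyl: "measure Q {\<omega>\<in>space Q. \<forall>k\<in>K. \<omega> k \<in> B k} = (\<Prod>k\<in>K. measure (\<mu> k) (B k))"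
    if "finite K" "\<And>k. B k \<in> sets borel" for K B
  proof -
    have "{\<omega>\<in>space Q. \<forall>k\<in>K. \<omega> k \<in> B k} = prod_emb UNIV \<mu> K (Pi\<^sub>E K B)"
      unfolding Q_def prod_emb_def by (auto simp: space_PiM)
    then show ?thesis
      unfolding Q_def using measure_PiM_emb[of K B] that sets_\<mu> by simp
  qed
  define P where "P = measure_pmf r \<Otimes>\<^sub>M Q"
  have P: "prob_space P"
    unfolding P_def by (rule prob_space_pair[OF measure_pmf.prob_space_axioms Q.prob_space_axioms])
  have space_P: "space P = UNIV \<times> space Q" by (simp add: P_def space_pair_measure)
  define X :: "'i \<Rightarrow> 'i set \<times> ('i \<times> bool \<Rightarrow> real) \<Rightarrow> real"
    where "X i \<omega> = (if i \<in> fst \<omega> then exp (snd \<omega> (i, fst \<omega> = {i})) else 0)" for i \<omega>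
  have X_meas [measurable]: "X i \<in> borel_measurable P" for i
  proof -
    \<comment> \<open>Which coordinate is read depends on the label, so \<open>X i\<close> is split
      by label events into pieces that each read a fixed coordinate.\<close>
    have X_eq: "X i = (\<lambda>\<omega>. if fst \<omega> \<in> {J. i \<in> J} then
        if fst \<omega> \<in> {{i}} then exp (snd \<omega> (i, True)) else exp (snd \<omega> (i, False)) else 0)"
      by (auto simp: X_def fun_eq_iff)
    have fst_P: "fst \<in> measurable P (count_space UNIV)"
      unfolding P_def by (rule measurable_compose[OF measurable_fst]) simp
    have lab: "{\<omega>\<in>space P. fst \<omega> \<in> S} \<in> sets P" for S
      using measurable_sets[OF fst_P, of S] by (simp add: vimage_def Int_def conj_commute)
    have "snd \<in> measurable P Q" unfolding P_def by (rule measurable_snd)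
    then have "(\<lambda>\<omega>. snd \<omega> k) \<in> borel_measurable P" for k
      by (rule measurable_compose[OF _ comp])
    then have ex: "(\<lambda>\<omega>. exp (snd \<omega> k)) \<in> borel_measurable P" for k
      by (rule measurable_compose[OF _ borel_measurable_exp])
    show ?thesis
      unfolding X_eq by (intro measurable_If ex lab) simp
  qed
  \<comment> \<open>Total probability: condition on the label, which takes values in
    \<open>Pow N\<close> only.\<close>
  have section_sum: "measure P A = (\<Sum>J\<in>Pow N. w J * measure Q (Pair J -` A))" if A: "A \<in> sets P" for A
  proof -
    have "emeasure P A = (\<integral>\<^sup>+J. emeasure Q (Pair J -` A) \<partial>measure_pmf r)"
      using Q.emeasure_pair_measure_alt A unfolding P_def by blast
    also have "\<dots> = (\<Sum>J\<in>Pow N. emeasure Q (Pair J -` A) * ennreal (pmf r J))"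
      by (rule nn_integral_measure_pmf_support) (use N set_r in auto)
    also have "\<dots> = (\<Sum>J\<in>Pow N. ennreal (w J * measure Q (Pair J -` A)))"
      by (simp add: pmf_r Q.emeasure_eq_measure ennreal_mult w0 mult.commute)
    also have "\<dots> = ennreal (\<Sum>J\<in>Pow N. w J * measure Q (Pair J -` A))"
      by (rule sum_ennreal) (simp add: w0)
    finally show ?thesis
      by (rule measure_eq_emeasure_eq_ennreal[rotated]) (simp add: w0 sum_nonneg)
  qed
  have joint: "measure P {\<omega>\<in>space P. (\<forall>i\<in>I. x i < X i \<omega>) \<and> (\<forall>j\<in>N - I. X j \<omega> = 0)} =
      w I * (\<Prod>i\<in>I. measure (\<mu> (i, I = {i})) {t. x i < exp t})"
    if I: "I \<subseteq> N" and x: "\<forall>i\<in>I. 0 \<le> x i" for I x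
  proof -
    let ?A = "{\<omega>\<in>space P. (\<forall>i\<in>I. x i < X i \<omega>) \<and> (\<forall>j\<in>N - I. X j \<omega> = 0)}"
    have fin [simp]: "finite I" using I N by (rule finite_subset)
    have A: "?A \<in> sets P"
      by (intro sets.sets_Collect_conj sets.sets_Collect_finite_All) (use N in \<open>auto intro: fin\<close>)
    \<comment> \<open>Since \<open>x i\<close> is non-negative, \<open>x i < X i \<omega>\<close>
      puts \<open>i\<close> into the label, and since exponentials are positive,
      \<open>X j \<omega> = 0\<close> keeps \<open>j\<close> out. Among subsets of \<open>N\<close>
      the event therefore forces the label \<open>I\<close>.\<close>
    have empty: "Pair J -` ?A = {}" if "J \<in> Pow N" "J \<noteq> I" for J
      using that x by (force simp: X_def)
    have "w J * measure Q (Pair J -` ?A) = (if J = I then w I * measure Q (Pair I -` ?A) else 0)"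
      if "J \<in> Pow N" for J
    proof (cases "J = I")
      case False
      show ?thesis unfolding empty[OF that False] using False by simp
    qed simp
    then have "(\<Sum>J\<in>Pow N. w J * measure Q (Pair J -` ?A)) =
        (\<Sum>J\<in>Pow N. if J = I then w I * measure Q (Pair I -` ?A) else 0)"
      by (rule sum.cong[OF refl])
    also have "\<dots> = w I * measure Q (Pair I -` ?A)" using I N by simp
    also have "Pair I -` ?A =
        {\<omega>\<in>space Q. \<forall>k\<in>(\<lambda>i. (i, I = {i})) ` I. \<omega> k \<in> {t. x (fst k) < exp t}}"
      by (auto simp: X_def space_P)
    also have "measure Q \<dots> = (\<Prod>k\<in>(\<lambda>i. (i, I = {i})) ` I. measure (\<mu> k) {t. x (fst k) < exp t})"
      by (rule cyl) auto
    also have "\<dots> = (\<Prod>i\<in>I. measure (\<mu> (i, I = {i})) {t. x i < exp t})"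
      by (subst prod.reindex) (auto simp: inj_on_def)
    finally show ?thesis using section_sum[OF A] by simp
  qed
  have marginal: "measure P {\<omega>\<in>space P. x < X i \<omega>} =
      (\<Sum>J\<in>{J\<in>Pow N. i \<in> J}. w J * measure (\<mu> (i, J = {i})) {t. x < exp t})"
    if x: "0 \<le> x" for i x
  proof -
    have A: "{\<omega>\<in>space P. x < X i \<omega>} \<in> sets P" by measurable
    have "measure Q (Pair J -` {\<omega>\<in>space P. x < X i \<omega>}) =
        (if i \<in> J then measure (\<mu> (i, J = {i})) {t. x < exp t} else 0)" for J
    proof (cases "i \<in> J")
      case True
      then have "Pair J -` {\<omega>\<in>space P. x < X i \<omega>} =
          {\<omega>\<in>space Q. \<forall>k\<in>{(i, J = {i})}. \<omega> k \<in> {t. x < exp t}}"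
        by (auto simp: X_def space_P)
      also have "measure Q \<dots> = (\<Prod>k\<in>{(i, J = {i})}. measure (\<mu> k) {t. x < exp t})"
        by (rule cyl) auto
      finally show ?thesis using True by simp
    next
      case False
      then have empty: "Pair J -` {\<omega>\<in>space P. x < X i \<omega>} = {}" using x by (auto simp: X_def)
      show ?thesis unfolding empty using False by simp
    qed
    then have "measure P {\<omega>\<in>space P. x < X i \<omega>} =
        (\<Sum>J\<in>Pow N. if i \<in> J then w J * measure (\<mu> (i, J = {i})) {t. x < exp t} else 0)"
      unfolding section_sum[OF A] by (intro sum.cong refl) auto
    then show ?thesis using N by (simp only: sum.inter_filter finite_Pow_iff)
  qed
  show thesis
    by (rule that[OF P X_meas _ joint marginal]) (auto simp: X_def)
qed

section \<open>Survival functions and the infimum \<open>G_star\<close>\<close>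

lemma nonneg_cdf_surv:
  assumes "nonneg_cdf F"
  shows surv_antimono: "x \<le> y \<Longrightarrow> surv F y \<le> surv F x"
    and surv_nonneg: "0 \<le> surv F x" and surv_le_1: "surv F x \<le> 1"
    and surv_neg: "x < 0 \<Longrightarrow> surv F x = 1"
    and surv_right_cont: "continuous (at_right x) (surv F)"
    and surv_lim: "(surv F \<longlongrightarrow> 0) at_top"
proof -
  obtain \<mu> where \<mu>: "real_distribution \<mu>" "measure \<mu> {0..} = 1" "F = cdf \<mu>"
    using assms by (auto simp: nonneg_cdf_def)
  interpret real_distribution \<mu> by fact
  show "x \<le> y \<Longrightarrow> surv F y \<le> surv F x" using cdf_nondecreasing \<mu>(3) by (simp add: surv_def)
  show "0 \<le> surv F x" "surv F x \<le> 1" using cdf_bounded_prob cdf_nonneg \<mu>(3) by (simp_all add: surv_def)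
  show "surv F x = 1" if "x < 0"
  proof -
    have "measure \<mu> {..x} + measure \<mu> {0..} = measure \<mu> ({..x} \<union> {0..})"
      by (rule finite_measure_Union[symmetric]) (use that in auto)
    then have "measure \<mu> {..x} = 0" using \<mu>(2) prob_le_1[of "{..x} \<union> {0..}"]
      by (smt (verit) measure_nonneg)
    then show ?thesis using \<mu>(3) by (simp add: surv_def cdf_def)
  qed
  show "continuous (at_right x) (surv F)"
    unfolding surv_def[abs_def] \<mu>(3) by (intro continuous_intros cdf_is_right_cont)
  show "(surv F \<longlongrightarrow> 0) at_top"
    using tendsto_diff[OF tendsto_const[of 1] cdf_lim_at_top_prob] \<mu>(3) by (simp add: surv_def[abs_def])
qed

text \<open>As the argument decreases to \<open>x\<close>, \<open>surv F\<close> approaches its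
  value at \<open>x\<close> from below, so left continuity of \<open>G\<close> is the matching
  notion. Once \<open>surv F\<close> has reached \<open>0\<close>, the composition is
  constant.\<close>

lemma right_cont_comp_surv:
  assumes F: "nonneg_cdf F"
    and G: "\<And>u. u \<in> {0<..1} \<Longrightarrow> continuous (at_left u) G"
  shows "continuous (at_right x) (\<lambda>x. G (surv F x))"
proof (cases "surv F x = 0")
  case True
  then have "surv F y = 0" if "x \<le> y" for y
    using surv_antimono[OF F that] surv_nonneg[OF F, of y] by simp
  then have "eventually (\<lambda>y. G (surv F y) = G (surv F x)) (at_right x)"
    by (auto simp: eventually_at_right_field True intro!: exI[of _ "x + 1"])
  then show ?thesis by (simp add: continuous_within tendsto_eventually)
next
  case False
  let ?u = "surv F x"
  have "?u \<in> {0<..1}" using False surv_nonneg[OF F, of x] surv_le_1[OF F, of x] by simp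
  \<comment> \<open>The image of \<open>{x<..}\<close> may contain \<open>?u\<close> itself, so left
    continuity is restated over the closed half-line, which defines the same filter.\<close>
  moreover have "{..?u} - {?u} = {..<?u} - {?u}" by auto
  ultimately have "continuous (at ?u within {..?u}) G"
    using G[of ?u] by (simp add: at_within_def)
  then have "continuous (at ?u within surv F ` {x<..}) G"
    by (rule continuous_within_subset) (use surv_antimono[OF F] in auto)
  then show ?thesis
    using continuous_within_compose[OF surv_right_cont[OF F, of x]] by (simp add: o_def)
qed

text \<open>The infimum with its denominator cleared, so that equal values of \<open>G\<close> are
  covered too. Real \<open>y\<close> will make \<open>surv F x - P * G (surv F x)\<close>
  non-increasing in \<open>x\<close>; \<open>y = \<infinity>\<close> with \<open>G 0 = 0\<close>
  will make it non-negative.\<close>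

lemma G_star_mult_le:
  assumes F: "nonneg_cdf F" and x: "0 \<le> x" "ereal x < y" and G: "G (surv_ext F y) \<le> G (surv F x)"
    and P: "P \<le> G_star F G"
  shows "P * (G (surv F x) - G (surv_ext F y)) \<le> surv F x - surv_ext F y"
proof -
  have ext: "surv_ext F y \<le> surv F x" if "ereal x < y" for x y
    using that surv_nonneg[OF F, of x] surv_antimono[OF F, of x "real_of_ereal y"]
    by (cases y) (auto simp: surv_ext_def)
  show ?thesis
  proof (cases "G (surv_ext F y) = G (surv F x)")
    case True
    then show ?thesis using ext[OF x(2)] by simp
  next
    case False
    then have lt: "G (surv_ext F y) < G (surv F x)" using G by simp
    have "G_star F G \<le> (surv F x - surv_ext F y) / (G (surv F x) - G (surv_ext F y))"
      unfolding G_star_def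
    proof (rule cInf_lower)
      show "bdd_below {(surv F x - surv_ext F y) / (G (surv F x) - G (surv_ext F y)) | x y.
          0 \<le> x \<and> ereal x < y \<and> G (surv F x) > G (surv_ext F y)}"
        by (rule bdd_belowI[of _ 0]) (use ext in auto)
    qed (use x lt in blast)
    with P have "P \<le> (surv F x - surv_ext F y) / (G (surv F x) - G (surv_ext F y))"
      by simp
    then show ?thesis using lt by (simp add: pos_le_divide_eq)
  qed
qed

text \<open>\<open>Inf\<close> of an empty set of reals carries no information, so a member is
  exhibited: \<open>x = 0\<close>, \<open>y = \<infinity>\<close>. Every quotient is non-negative
  because \<open>surv F\<close> is non-increasing.\<close>

lemma G_star_nonneg:
  assumes F: "nonneg_cdf F" and G: "G 0 < G (surv F 0)"
  shows "0 \<le> G_star F G"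
  unfolding G_star_def
proof (rule cInf_greatest)
  have "\<exists>x y. 0 \<le> x \<and> ereal x < y \<and> G (surv F x) > G (surv_ext F y)"
    using G by (intro exI[of _ 0] exI[of _ \<infinity>]) (simp add: surv_ext_def)
  then show "{(surv F x - surv_ext F y) / (G (surv F x) - G (surv_ext F y)) | x y.
      0 \<le> x \<and> ereal x < y \<and> G (surv F x) > G (surv_ext F y)} \<noteq> {}" by blast
next
  fix q assume "q \<in> {(surv F x - surv_ext F y) / (G (surv F x) - G (surv_ext F y)) | x y.
      0 \<le> x \<and> ereal x < y \<and> G (surv F x) > G (surv_ext F y)}"
  then obtain x y where q: "q = (surv F x - surv_ext F y) / (G (surv F x) - G (surv_ext F y))"
    "ereal x < y" "G (surv F x) > G (surv_ext F y)" by blast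
  have "surv_ext F y \<le> surv F x"
    using q(2) surv_nonneg[OF F, of x] surv_antimono[OF F, of x "real_of_ereal y"]
    by (cases y) (auto simp: surv_ext_def)
  then show "0 \<le> q" using q by simp
qed

section \<open>Linear program: upper bound\<close>

text \<open>For the first bound, \<open>card I \<le> n - 1\<close> makes \<open>card I - 1\<close>
  at most \<open>(n - 2) / (n - 1)\<close> times \<open>card I\<close>. For the second, the total
  weight is at least the marginal sum at an index \<open>m\<close> maximising \<open>q\<close>, so
  subtracting it removes at least that marginal.\<close>

lemma weights_bound:
  fixes p :: "nat set \<Rightarrow> real" and q :: "nat \<Rightarrow> real"
  assumes n: "n \<ge> 2" and p: "\<And>I. I \<in> index_family n \<Longrightarrow> 0 \<le> p I"
    and q: "\<And>i. i \<in> {1..n} \<Longrightarrow> (\<Sum>I\<in>index_family_at n i. p I) \<le> q i"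
  defines "Q \<equiv> \<Sum>i\<in>{1..n}. q i"
  shows "(\<Sum>I\<in>index_family n. (real (card I) - 1) * p I) \<le>
    min ((real n - 2) / (real n - 1) * Q) (Q - Max (q ` {1..n}))"
proof (rule min.boundedI)
  define R where "R i = (\<Sum>I\<in>index_family_at n i. p I)" for i
  have R: "(\<Sum>I\<in>index_family n. real (card I) * p I) = (\<Sum>i\<in>{1..n}. R i)"
    using sum_card_mult[OF _ index_family_subset, of n p]
    by (simp add: R_def index_family_at_def)
  have RQ: "(\<Sum>i\<in>A. R i) \<le> (\<Sum>i\<in>A. q i)" if "A \<subseteq> {1..n}" for A
    by (rule sum_mono) (use q that in \<open>auto simp: R_def\<close>)
  have "(real (card I) - 1) * p I \<le> (real n - 2) / (real n - 1) * (real (card I) * p I)"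
    if I: "I \<in> index_family n" for I
  proof -
    have "real (card I) \<le> real n - 1" using I n by (auto simp: index_family_def)
    then have "real (card I) - 1 \<le> (real n - 2) / (real n - 1) * real (card I)"
      using n by (simp add: field_simps)
    from mult_right_mono[OF this p[OF I]] show ?thesis by (simp add: mult.assoc)
  qed
  then have "(\<Sum>I\<in>index_family n. (real (card I) - 1) * p I) \<le>
      (real n - 2) / (real n - 1) * (\<Sum>i\<in>{1..n}. R i)"
    unfolding R[symmetric] sum_distrib_left by (rule sum_mono)
  also have "\<dots> \<le> (real n - 2) / (real n - 1) * Q"
    unfolding Q_def using RQ[OF order_refl] n by (intro mult_left_mono) auto
  finally show "(\<Sum>I\<in>index_family n. (real (card I) - 1) * p I) \<le> (real n - 2) / (real n - 1) * Q" .
  have "Max (q ` {1..n}) \<in> q ` {1..n}" using n by (intro Max_in) auto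
  then obtain m where m: "m \<in> {1..n}" "Max (q ` {1..n}) = q m" by auto
  have "R m \<le> (\<Sum>I\<in>index_family n. p I)"
    unfolding R_def by (rule sum_mono2) (use p in \<open>auto simp: index_family_at_def\<close>)
  then have "(\<Sum>I\<in>index_family n. (real (card I) - 1) * p I) \<le> (\<Sum>i\<in>{1..n}. R i) - R m"
    by (simp add: left_diff_distrib sum_subtractf R del: One_nat_def)
  also have "\<dots> = (\<Sum>i\<in>{1..n} - {m}. R i)" using m(1) by (simp add: sum_diff1)
  also have "\<dots> \<le> (\<Sum>i\<in>{1..n} - {m}. q i)" by (rule RQ) auto
  also have "\<dots> = Q - q m" using m(1) by (simp add: sum_diff1 Q_def)
  finally show "(\<Sum>I\<in>index_family n. (real (card I) - 1) * p I) \<le> Q - Max (q ` {1..n})"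
    using m(2) by simp
qed

section \<open>Construction of a G-JE vector from feasible coefficients\<close>

text \<open>The set of positive components is \<open>I\<close> with probability \<open>p I\<close>,
  \<open>{i}\<close> with probability \<open>surv (F i) 0 - R i\<close>, and empty with the
  remaining probability \<open>c\<close>; the full set gets \<open>0\<close>. On labels of positive
  weight that contain \<open>i\<close>, component \<open>i\<close> has survival function
  proportional to \<open>s i True\<close> if it is alone and to \<open>s i False\<close> otherwise.
  These two functions add up to \<open>surv (F i)\<close>.\<close>

lemma GJE_exists:
  fixes n :: nat and F G :: "nat \<Rightarrow> real \<Rightarrow> real" and p :: "nat set \<Rightarrow> real"
  assumes n: "n \<ge> 2"
    and F: "\<And>i. i \<in> {1..n} \<Longrightarrow> nonneg_cdf (F i)"
    and G_mono: "\<And>i. i \<in> {1..n} \<Longrightarrow> mono_on {0..1} (G i)"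
    and G_left_cont: "\<And>i u. i \<in> {1..n} \<Longrightarrow> u \<in> {0<..1} \<Longrightarrow> continuous (at_left u) (G i)"
    and G0: "\<And>i. i \<in> {1..n} \<Longrightarrow> G i 0 = 0"
    and G1: "\<And>i. i \<in> {1..n} \<Longrightarrow> G i (surv (F i) 0) = 1"
    and p0: "\<And>I. 0 \<le> p I"
    and p_le: "\<And>i. i \<in> {1..n} \<Longrightarrow> (\<Sum>I\<in>index_family_at n i. p I) \<le> G_star (F i) (G i)"
    and p_ge: "(\<Sum>i\<in>{1..n}. surv (F i) 0) - 1 \<le> (\<Sum>I\<in>index_family n. (real (card I) - 1) * p I)"
  shows "\<exists>(P :: (nat \<Rightarrow> real) measure) X. GJE n F G P X"
proof -
  let ?N = "{1..n}"
  define R where "R i = (\<Sum>I\<in>index_family_at n i. p I)" for i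
  have R0: "0 \<le> R i" for i unfolding R_def by (rule sum_nonneg) (rule p0)
  define g where "g i x = G i (surv (F i) x)" for i x
  have g_anti: "g i y \<le> g i x" if "i \<in> ?N" "x \<le> y" for i x y
    unfolding g_def using surv_antimono[OF F that(2)] surv_nonneg[OF F] surv_le_1[OF F] that(1)
    by (intro mono_onD[OF G_mono]) auto
  have g_nonneg: "0 \<le> g i x" if "i \<in> ?N" for i x
    using mono_onD[OF G_mono[OF that], of 0 "surv (F i) x"] surv_nonneg[OF F[OF that]]
      surv_le_1[OF F[OF that]] G0[OF that] by (simp add: g_def)
  have R_diff: "R i * (g i x - g i y) \<le> surv (F i) x - surv (F i) y"
    if "i \<in> ?N" "0 \<le> x" "x \<le> y" for i x y
  proof (cases "x = y")
    case False
    then show ?thesis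
      using G_star_mult_le[OF F[OF that(1)] that(2), of "ereal y" "G i" "R i"] that
        g_anti[OF that(1,3)] p_le[OF that(1)] by (simp add: surv_ext_def g_def R_def)
  qed simp
  \<comment> \<open>Here \<open>y = \<infinity>\<close> enters: the resulting domination by
    \<open>surv (F i)\<close> keeps the part for a lone positive component non-negative and drives
    \<open>R i * g i x\<close> to \<open>0\<close>.\<close>
  have R_g: "R i * g i x \<le> surv (F i) x" if "i \<in> ?N" "0 \<le> x" for i x
    using G_star_mult_le[OF F[OF that(1)] that(2), of \<infinity> "G i" "R i"] that
        g_nonneg[OF that(1), of x] p_le[OF that(1)] G0 by (simp add: surv_ext_def g_def R_def)
  have g_cont: "continuous (at_right x) (g i)" if "i \<in> ?N" for i x
    unfolding g_def by (rule right_cont_comp_surv[OF F[OF that] G_left_cont[OF that]])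
  have R_g_lim: "((\<lambda>x. R i * g i x) \<longlongrightarrow> 0) at_top" if "i \<in> ?N" for i
  proof (rule tendsto_sandwich[OF _ _ tendsto_const surv_lim[OF F[OF that]]])
    show "\<forall>\<^sub>F x in at_top. 0 \<le> R i * g i x"
      using R0 g_nonneg[OF that] by simp
    show "\<forall>\<^sub>F x in at_top. R i * g i x \<le> surv (F i) x"
      using R_g[OF that] by (auto intro: eventually_at_top_linorderI[of 0])
  qed
  \<comment> \<open>The factor \<open>R i\<close> is kept in because \<open>g i\<close> alone need not tend to \<open>0\<close> when \<open>R i = 0\<close>.\<close>
  define s where "s i single x = (if single then surv (F i) x - R i * g i x else R i * g i x)"
    for i single x
  have s_nonneg: "0 \<le> s i single x" if "i \<in> ?N" "0 \<le> x" for i single x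
    using R_g[OF that] R0 g_nonneg[OF that(1)] by (simp add: s_def)
  have law: "\<exists>\<mu>. real_distribution \<mu> \<and> (\<forall>x\<ge>0. s i single x = s i single 0 * measure \<mu> {t. x < exp t})"
    if i: "i \<in> ?N" for i single
  proof (rule survival_law)
    show "s i single y \<le> s i single x" if "0 \<le> x" "x \<le> y" for x y
      using R_diff[OF i that] mult_left_mono[OF g_anti[OF i that(2)] R0]
      by (simp add: s_def algebra_simps)
    show "continuous (at_right x) (s i single)" for x
      using g_cont[OF i, of x] surv_right_cont[OF F[OF i], of x]
      unfolding s_def[abs_def] by (cases single) (auto intro!: continuous_intros)
    show "(s i single \<longlongrightarrow> 0) at_top"
      using R_g_lim[OF i] tendsto_diff[OF surv_lim[OF F[OF i]] R_g_lim[OF i]]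
      unfolding s_def[abs_def] by (cases single) auto
  qed
  \<comment> \<open>The product measure asks for a law at every index; outside \<open>?N\<close> any
    law serves, here one of component \<open>1\<close>.\<close>
  have "\<exists>\<mu>. real_distribution \<mu> \<and> (fst k \<in> ?N \<longrightarrow>
      (\<forall>x\<ge>0. s (fst k) (snd k) x = s (fst k) (snd k) 0 * measure \<mu> {t. x < exp t}))" for k
    using law[of "fst k" "snd k"] law[of 1 True] n by (cases "fst k \<in> ?N") auto
  then obtain \<mu> where \<mu>: "\<And>k. real_distribution (\<mu> k)" and
    \<mu>_s: "\<And>k x. fst k \<in> ?N \<Longrightarrow> 0 \<le> x \<Longrightarrow>
        s (fst k) (snd k) x = s (fst k) (snd k) 0 * measure (\<mu> k) {t. x < exp t}"
    by metis
  note \<mu>_s = \<mu>_s[of "(i, single)" for i single, unfolded fst_conv snd_conv]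
  define c where "c = 1 - (\<Sum>i\<in>?N. surv (F i) 0) + (\<Sum>I\<in>index_family n. (real (card I) - 1) * p I)"
  \<comment> \<open>At most one of the terms is non-zero for a given \<open>J\<close>, and the sum
    form lets the total over \<open>Pow ?N\<close> split.\<close>
  define w where "w J = (if J \<in> index_family n then p J else 0) + (if J = {} then c else 0) +
    (\<Sum>i\<in>?N. if J = {i} then s i True 0 else 0)" for J
  have c0: "0 \<le> c" using p_ge by (simp add: c_def)
  have fam: "J \<noteq> {}" "J \<noteq> {i}" if "J \<in> index_family n" for J i
    using that by (auto simp: index_family_def)
  have w_fam: "w J = p J" if "J \<in> index_family n" for J
    using that fam[OF that] by (simp add: w_def)
  have w_single: "w {i} = s i True 0" if "i \<in> ?N" for i
    using that fam(2)[of "{i}" i] by (auto simp: w_def)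
  have w_empty: "w {} = c" using fam(1)[of "{}"] by (auto simp: w_def)
  have w_other: "w J = 0" if "J \<notin> index_family n" "J \<noteq> {}" "\<And>i. i \<in> ?N \<Longrightarrow> J \<noteq> {i}" for J
    using that by (simp add: w_def)
  have w0: "0 \<le> w J" for J
    unfolding w_def using p0 c0 s_nonneg by (intro add_nonneg_nonneg sum_nonneg) auto
  have w_out: "w J = 0" if "J \<notin> Pow ?N" for J
    using that index_family_subset by (intro w_other) auto
  have single: "s i True 0 = surv (F i) 0 - R i" if "i \<in> ?N" for i
    using G1[OF that] by (simp add: s_def g_def)
  have R_sum: "(\<Sum>I\<in>index_family n. real (card I) * p I) = (\<Sum>i\<in>?N. R i)"
    using sum_card_mult[OF _ index_family_subset, of n p]
    by (simp add: R_def index_family_at_def)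
  \<comment> \<open>By \<open>R_sum\<close>, subtracting all \<open>R i\<close> removes the sum of
    \<open>card I * p I\<close>, and \<open>c\<close> is exactly what then completes the total to
    \<open>1\<close>.\<close>
  have w1: "(\<Sum>J\<in>Pow ?N. w J) = 1"
  proof -
    have "(\<Sum>J\<in>Pow ?N. if J \<in> index_family n then p J else 0) = (\<Sum>J\<in>index_family n. p J)"
      using index_family_subset[of n] by (simp add: sum.If_cases Int_absorb1 del: One_nat_def)
    moreover have "(\<Sum>J\<in>Pow ?N. if J = {} then c else 0) = c" by simp
    moreover have "(\<Sum>J\<in>Pow ?N. \<Sum>i\<in>?N. if J = {i} then s i True 0 else 0) =
        (\<Sum>i\<in>?N. \<Sum>J\<in>Pow ?N. if J = {i} then s i True 0 else 0)"
      by (rule sum.swap)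
    moreover have "\<dots> = (\<Sum>i\<in>?N. surv (F i) 0 - R i)"
      by (intro sum.cong refl) (simp add: single)
    ultimately have "(\<Sum>J\<in>Pow ?N. w J) =
        (\<Sum>J\<in>index_family n. p J) + c + (\<Sum>i\<in>?N. surv (F i) 0 - R i)"
      by (simp add: w_def sum.distrib)
    then show ?thesis
      by (simp add: c_def left_diff_distrib sum_subtractf R_sum del: One_nat_def)
  qed
  show ?thesis
  proof (rule labelled_vector[of ?N w \<mu>])
    fix P :: "(nat set \<times> (nat \<times> bool \<Rightarrow> real)) measure" and X
    assume P: "prob_space P" and X: "\<And>i. X i \<in> borel_measurable P" "\<And>i \<omega>. 0 \<le> X i \<omega>"
      and joint: "\<And>I x. I \<subseteq> ?N \<Longrightarrow> \<forall>i\<in>I. 0 \<le> x i \<Longrightarrow>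
        measure P {\<omega>\<in>space P. (\<forall>i\<in>I. x i < X i \<omega>) \<and> (\<forall>j\<in>?N - I. X j \<omega> = 0)} =
          w I * (\<Prod>i\<in>I. measure (\<mu> (i, I = {i})) {t. x i < exp t})"
      and marginal: "\<And>i x. 0 \<le> x \<Longrightarrow> measure P {\<omega>\<in>space P. x < X i \<omega>} =
          (\<Sum>J\<in>{J\<in>Pow ?N. i \<in> J}. w J * measure (\<mu> (i, J = {i})) {t. x < exp t})"
    interpret prob_space P by (rule P)
    \<comment> \<open>The members of \<open>index_family n\<close> containing \<open>i\<close> share
      one law for \<open>X i\<close> and have total weight \<open>R i = s i False 0\<close>.
      Together with \<open>{i}\<close> they recombine to
      \<open>s i False x + s i True x\<close>.\<close>
    have surv_X: "measure P {\<omega>\<in>space P. x < X i \<omega>} = surv (F i) x" if i: "i \<in> ?N" and x: "0 \<le> x" for i x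
    proof -
      let ?m = "\<lambda>single. measure (\<mu> (i, single)) {t. x < exp t}"
      have "w J * ?m (J = {i}) = (if J \<in> index_family n then p J * ?m False else 0) +
          (if J = {i} then s i True 0 * ?m True else 0)" if "J \<in> {J\<in>Pow ?N. i \<in> J}" for J
        using that w_fam[of J] w_single[OF i] fam(2)[of J i] w_other[of J] by (cases "J = {i}") auto
      then have "measure P {\<omega>\<in>space P. x < X i \<omega>} =
          (\<Sum>J\<in>{J\<in>Pow ?N. i \<in> J}. if J \<in> index_family n then p J * ?m False else 0) +
          (\<Sum>J\<in>{J\<in>Pow ?N. i \<in> J}. if J = {i} then s i True 0 * ?m True else 0)"
        unfolding marginal[OF x] sum.distrib[symmetric] by (intro sum.cong refl) auto
      also have "(\<Sum>J\<in>{J\<in>Pow ?N. i \<in> J}. if J \<in> index_family n then p J * ?m False else 0) =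
          (\<Sum>J\<in>index_family_at n i. p J * ?m False)"
        by (rule sum.mono_neutral_cong_right) (use index_family_subset in \<open>auto simp: index_family_at_def\<close>)
      also have "\<dots> = s i False 0 * ?m False"
        using G1[OF i] by (simp add: sum_distrib_right R_def s_def g_def)
      also have "(\<Sum>J\<in>{J\<in>Pow ?N. i \<in> J}. if J = {i} then s i True 0 * ?m True else 0) = s i True 0 * ?m True"
        using i by simp
      finally show ?thesis unfolding \<mu>_s[OF i x, symmetric] by (simp add: s_def)
    qed
    \<comment> \<open>The factor \<open>p I\<close> stays because the law at
      \<open>(i, False)\<close> is arbitrary when \<open>R i = 0\<close>. If \<open>p I\<close> is
      non-zero, then \<open>R i \<ge> p I > 0\<close> and \<open>R i\<close> cancels.\<close>
    have p_g: "p I * measure (\<mu> (i, False)) {t. x < exp t} = p I * g i x"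
      if I: "I \<in> index_family n" and i: "i \<in> I" and x: "0 \<le> x" for I i x
    proof (cases "p I = 0")
      case False
      have iN: "i \<in> ?N" using I i index_family_subset by blast
      have "p I \<le> R i" unfolding R_def
        by (rule member_le_sum) (use I i p0 in \<open>auto simp: index_family_at_def\<close>)
      then have "R i > 0" using False p0[of I] by simp
      moreover have "R i * g i x = R i * measure (\<mu> (i, False)) {t. x < exp t}"
        using \<mu>_s[OF iN x, of False] G1[OF iN] by (simp add: s_def g_def)
      ultimately show ?thesis by simp
    qed simp
    have "GJE n F G P X"
      unfolding GJE_def nonneg_random_vector_def
    proof (intro conjI exI[of _ p] exI[of _ "\<lambda>I u. \<Prod>i\<in>I. u i"] ballI allI impI P X p0)
      fix i assume i: "i \<in> ?N"
      show "cdf (distr P borel (X i)) = F i"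
      proof
        fix x
        have "cdf (distr P borel (X i)) x = measure P {\<omega>\<in>space P. X i \<omega> \<le> x}"
          unfolding cdf_def by (subst measure_distr) (use X in \<open>auto simp: vimage_def Int_def conj_commute\<close>)
        also have "\<dots> = 1 - measure P {\<omega>\<in>space P. x < X i \<omega>}"
          using prob_neg[of "\<lambda>\<omega>. x < X i \<omega>"] X(1)[of i] by (simp add: not_less)
        also have "\<dots> = F i x"
        proof (cases "0 \<le> x")
          case True
          then show ?thesis using surv_X[OF i True] by (simp add: surv_def)
        next
          case False
          then have "{\<omega>\<in>space P. x < X i \<omega>} = space P"
            using X(2)[of i] by (auto intro: less_le_trans[of x 0])
          then show ?thesis using surv_neg[OF F[OF i], of x] False prob_space by (simp add: surv_def)
        qed
        finally show "cdf (distr P borel (X i)) x = F i x" .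
      qed
    next
      fix I assume "I \<in> index_family n"
      then have "finite I" using index_family_subset finite_subset by blast
      then show "copula I (\<lambda>u. \<Prod>i\<in>I. u i)" by (rule copula_prod)
    next
      fix I and x :: "nat \<Rightarrow> real"
      assume I: "I \<in> index_family n" and x: "\<forall>i\<in>I. 0 \<le> x i"
      have "I \<subseteq> ?N" using I index_family_subset by blast
      have "p I * (\<Prod>i\<in>I. measure (\<mu> (i, I = {i})) {t. x i < exp t}) = p I * (\<Prod>i\<in>I. g i (x i))"
      proof (cases "p I = 0")
        case False
        then have "measure (\<mu> (i, I = {i})) {t. x i < exp t} = g i (x i)" if "i \<in> I" for i
          using p_g[OF I that, of "x i"] x that fam(2)[OF I, of i] by simp
        then show ?thesis by simp
      qed simp
      then show "measure P {\<omega>\<in>space P. (\<forall>i\<in>I. x i < X i \<omega>) \<and> (\<forall>j\<in>?N - I. X j \<omega> = 0)} =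
          p I * (\<Prod>i\<in>I. (\<lambda>i\<in>I. G i (surv (F i) (x i))) i)"
        using joint[OF \<open>I \<subseteq> ?N\<close> x] w_fam[OF I] by (simp add: g_def)
    next
      fix i and x :: real assume i: "i \<in> ?N" and x: "0 \<le> x"
      have "measure P {\<omega>\<in>space P. x < X i \<omega> \<and> (\<forall>j\<in>?N - {i}. X j \<omega> = 0)} =
          s i True 0 * measure (\<mu> (i, True)) {t. x < exp t}"
        using joint[of "{i}" "\<lambda>_. x"] w_single[OF i] i x by simp
      also have "\<dots> = s i True x" using \<mu>_s[OF i x, of True] by simp
      finally show "measure P {\<omega>\<in>space P. x < X i \<omega> \<and> (\<forall>j\<in>?N - {i}. X j \<omega> = 0)} =
          surv (F i) x - (\<Sum>I\<in>index_family_at n i. p I) * G i (surv (F i) x)"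
        by (simp add: s_def R_def g_def)
    next
      show "measure P {\<omega>\<in>space P. \<forall>i\<in>?N. X i \<omega> = 0} =
          1 - (\<Sum>i\<in>?N. surv (F i) 0) + (\<Sum>I\<in>index_family n. (real (card I) - 1) * p I)"
        using joint[of "{}" "\<lambda>_. 0"] w_empty by (simp add: c_def)
    qed (use p_ge p_le in auto)
    \<comment> \<open>The vector built here lives on pairs of a label and a coordinate family; its
      law is moved to \<open>nat \<Rightarrow> real\<close>.\<close>
    then show ?thesis by (rule GJE_transfer)
  qed (use w0 w1 \<mu> in \<open>simp_all add: w_out del: One_nat_def\<close>)
qed

section \<open>Existence criterion from the two sides of the linear program\<close>

theorem theorem3p8:
  fixes n :: nat and F G :: "nat \<Rightarrow> real \<Rightarrow> real" and a b :: "nat \<Rightarrow> real"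
  assumes n: "n \<ge> 2"
    and F: "\<And>i. i \<in> {1..n} \<Longrightarrow> nonneg_cdf (F i)"
    and G_range: "\<And>i. i \<in> {1..n} \<Longrightarrow> G i \<in> {0..1} \<rightarrow> {0..1}"
    and G_mono: "\<And>i. i \<in> {1..n} \<Longrightarrow> mono_on {0..1} (G i)"
    and G_left_cont: "\<And>i u. i \<in> {1..n} \<Longrightarrow> u \<in> {0<..1} \<Longrightarrow> continuous (at_left u) (G i)"
    and ab: "\<And>i. i \<in> {1..n} \<Longrightarrow> 0 \<le> a i \<and> a i < b i \<and> b i \<le> surv (F i) 0"
    and G_zero: "\<And>i u. i \<in> {1..n} \<Longrightarrow> u \<in> {0..a i} \<Longrightarrow> G i u = 0"
    and G_one: "\<And>i u. i \<in> {1..n} \<Longrightarrow> u \<in> {b i..1} \<Longrightarrow> G i u = 1"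
  shows "(\<exists>(P :: (nat \<Rightarrow> real) measure) X. GJE n F G P X) \<longleftrightarrow>
    (\<Sum>i\<in>{1..n}. surv (F i) 0) - 1 \<le>
      min ((real n - 2) / (real n - 1) * (\<Sum>i\<in>{1..n}. G_star (F i) (G i)))
          ((\<Sum>i\<in>{1..n}. G_star (F i) (G i)) - Max ((\<lambda>i. G_star (F i) (G i)) ` {1..n}))"
    (is "?L \<longleftrightarrow> ?d \<le> ?m")
proof
  assume ?L
  \<comment> \<open>The coefficients of a G-JE vector are feasible for the linear program, and
    \<open>GJE\<close> itself bounds their objective below by \<open>?d\<close>.\<close>
  then obtain p :: "nat set \<Rightarrow> real" where p: "\<forall>I\<in>index_family n. 0 \<le> p I"
    "\<forall>i\<in>{1..n}. (\<Sum>I\<in>index_family_at n i. p I) \<le> G_star (F i) (G i)"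
    and ge: "?d \<le> (\<Sum>I\<in>index_family n. (real (card I) - 1) * p I)"
    unfolding GJE_def by (elim exE conjE) (rule that; simp)
  note ge
  also have "(\<Sum>I\<in>index_family n. (real (card I) - 1) * p I) \<le> ?m"
    by (rule weights_bound[OF n]) (use p in auto)
  finally show "?d \<le> ?m" .
next
  assume d: "?d \<le> ?m"
  have G0: "G i 0 = 0" and G1: "G i (surv (F i) 0) = 1" if "i \<in> {1..n}" for i
    using G_zero[OF that, of 0] G_one[OF that, of "surv (F i) 0"] ab[OF that]
      surv_le_1[OF F[OF that], of 0] by auto
  have star0: "0 \<le> G_star (F i) (G i)" if "i \<in> {1..n}" for i
    using G_star_nonneg[OF F[OF that]] G0[OF that] G1[OF that] by simp
  show ?L
  proof (rule weights_exist[of n "\<lambda>i. G_star (F i) (G i)", OF n star0])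
    fix p :: "nat set \<Rightarrow> real"
    assume p: "\<And>I. 0 \<le> p I"
      "\<And>i. i \<in> {1..n} \<Longrightarrow> (\<Sum>I\<in>index_family_at n i. p I) \<le> G_star (F i) (G i)"
      and ge: "?m \<le> (\<Sum>I\<in>index_family n. (real (card I) - 1) * p I)"
    show ?L
      by (rule GJE_exists[OF n F G_mono G_left_cont G0 G1 p order_trans[OF d ge]])
  qed
qed

end
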